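(* Let $Y$ have the stationary distribution of the Markov chain $(Y_m)_m$, and write $\bar P:=1-P$, $\bar R:=1-R$. Then $$\mathbb E\,Y=N\,\frac{1-\mathbb E P}{2-\mathbb E P-\mathbb E R},\qquad \mathbb V\mathrm{ar}\,Y=\gamma_1N^2+\gamma_2N,$$ where $$\gamma_1=\frac{\mathbb E(\bar R^2)(\mathbb E\bar P)^2-2\,\mathbb E(\bar P\bar R)\,\mathbb E\bar P\,\mathbb E\bar R+\mathbb E(\bar P^2)(\mathbb E\bar R)^2}{\big(1-\mathbb E((\bar P+\bar R-1)^2)\big)\big(\mathbb E\bar P+\mathbb E\bar R\big)^2},$$ $$\gamma_2=\frac{-\mathbb E(\bar R^2)\,\mathbb E\bar P+2\,\mathbb E\bar P\,\mathbb E\bar R-\mathbb E(\bar P^2)\,\mathbb E\bar R}{\big(1-\mathbb E((\bar P+\bar R-1)^2)\big)\big(\mathbb E\bar P+\mathbb E\bar R\big)}.$$ Moreover, $$\lim_{m\to\infty}\mathbb C\mathrm{ov}(Y_m,Y_{m+1})=(\mathbb EP+\mathbb ER-1)\,\mathbb E(Y^2)+(1-\mathbb EP)\,N\,\mathbb E\,Y-(\mathbb E\,Y)^2 .$$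
   Context: Erdős–Rényi graph with resampling: $(P_m,R_m)_{m\in\mathbb N}$ is a sequence of i.i.d. random vectors in $(0,1)^2$ with generic copy $(P,R)$ ($P_m$ and $R_m$ need not be independent of each other). There are $N$ edges, each in state $0$ (absent) or $1$ (present). In slot $m$, given $(P_m,R_m)$ and the states at time $m-1$, all edges move independently of one another according to the same transition matrix on $\{0,1\}$ $$\begin{pmatrix}P_m&1-P_m\\1-R_m&R_m\end{pmatrix},$$ i.e. an absent edge stays absent with probability $P_m$ and a present edge stays present with probability $R_m$; $(P_m,R_m)$ is independent of the past. $Y_m$ is the number of present edges at time $m$, a Markov chain on $\{0,\dots,N\}$. *)

theory Defs
  imports "HOL-Probability.Probability"
begin

text \<open>
  The \<^term>\<open>N\<close> edges are labelled by \<^term>\<open>{..<N}\<close>; a graph is represented by the set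
  \<open>S \<subseteq> {..<N}\<close> of its present edges.
\<close>

definition edge_trans :: "real \<Rightarrow> real \<Rightarrow> bool \<Rightarrow> bool \<Rightarrow> real" where
  "edge_trans p r s t =
     (if \<not> s \<and> \<not> t then p
      else if \<not> s \<and> t then 1 - p
      else if s \<and> \<not> t then 1 - r
      else r)"

definition graph_trans :: "nat \<Rightarrow> real \<Rightarrow> real \<Rightarrow> nat set \<Rightarrow> nat set \<Rightarrow> real" where
  "graph_trans N p r S T = (\<Prod>e<N. edge_trans p r (e \<in> S) (e \<in> T))"

text \<open>
  In \<open>count_trans\<close> the probability of moving from \<open>i\<close> to \<open>j\<close> present edges, given the
  resampling parameters, is computed from the graph with edge set \<^term>\<open>{..<i}\<close>. Any other graph
  with \<open>i\<close> edges gives the same value (lemma \<open>count_trans_eq\<close>), which is why the number of present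
  edges is itself a Markov chain.
\<close>

definition count_trans :: "nat \<Rightarrow> real \<Rightarrow> real \<Rightarrow> nat \<Rightarrow> nat \<Rightarrow> real" where
  "count_trans N p r i j = (\<Sum>T | T \<subseteq> {..<N} \<and> card T = j. graph_trans N p r {..<i} T)"

lemma count_trans_eq:
  assumes "S \<subseteq> {..<N}"
  shows "(\<Sum>T | T \<subseteq> {..<N} \<and> card T = j. graph_trans N p r S T) = count_trans N p r (card S) j"
proof -
  have finS: "finite S" and cS: "card S \<le> N"
    using assms finite_subset card_mono[OF _ assms] by auto
  obtain f where f: "bij_betw f S {..<card S}"
    using finS finite_same_card_bij[of S "{..<card S}"] by auto
  have "card ({..<N} - S) = card ({..<N} - {..<card S})"
    using assms finS cS by (simp add: card_Diff_subset)
  then obtain g where g: "bij_betw g ({..<N} - S) ({..<N} - {..<card S})"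
    using finite_same_card_bij[of "{..<N} - S" "{..<N} - {..<card S}"] by auto
  define h where "h e = (if e \<in> S then f e else g e)" for e
  have hS: "bij_betw h S {..<card S}"
    using f by (subst bij_betw_cong[where g = f]) (auto simp: h_def)
  have hC: "bij_betw h ({..<N} - S) ({..<N} - {..<card S})"
    using g by (subst bij_betw_cong[where g = g]) (auto simp: h_def)
  have "bij_betw h (S \<union> ({..<N} - S)) ({..<card S} \<union> ({..<N} - {..<card S}))"
    by (rule bij_betw_combine[OF hS hC]) auto
  moreover have "S \<union> ({..<N} - S) = {..<N}" "{..<card S} \<union> ({..<N} - {..<card S}) = {..<N}"
    using assms cS by auto
  ultimately have h: "bij_betw h {..<N} {..<N}" by simp
  have inj: "inj_on h {..<N}" and im: "h ` {..<N} = {..<N}"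
    using h by (auto simp: bij_betw_def)
  have mem: "h e < card S \<longleftrightarrow> e \<in> S" if "e < N" for e
  proof (cases "e \<in> S")
    case True
    then show ?thesis using bij_betwE[OF hS] by auto
  next
    case False
    then have "h e \<in> {..<N} - {..<card S}" using bij_betwE[OF hC] that by auto
    then show ?thesis using False by auto
  qed
  have step: "graph_trans N p r S T = graph_trans N p r {..<card S} (h ` T)"
    if T: "T \<subseteq> {..<N}" for T
  proof -
    have "graph_trans N p r {..<card S} (h ` T)
        = (\<Prod>e<N. edge_trans p r (h e \<in> {..<card S}) (h e \<in> h ` T))"
      unfolding graph_trans_def
      by (rule prod.reindex_bij_betw[OF h, symmetric])
    also have "\<dots> = graph_trans N p r S T"
      unfolding graph_trans_def
    proof (rule prod.cong[OF refl])
      fix e assume "e \<in> {..<N}"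
      then show "edge_trans p r (h e \<in> {..<card S}) (h e \<in> h ` T)
          = edge_trans p r (e \<in> S) (e \<in> T)"
        using mem[of e] inj_on_image_mem_iff[OF inj _ T, of e] by simp
    qed
    finally show ?thesis by simp
  qed
  have bijP: "bij_betw ((`) h) {T. T \<subseteq> {..<N} \<and> card T = j} {T. T \<subseteq> {..<N} \<and> card T = j}"
  proof (rule bij_betw_imageI)
    show "inj_on ((`) h) {T. T \<subseteq> {..<N} \<and> card T = j}"
      by (rule inj_onI) (use inj inj_on_image_eq_iff in blast)
    show "(`) h ` {T. T \<subseteq> {..<N} \<and> card T = j} = {T. T \<subseteq> {..<N} \<and> card T = j}"
    proof (intro equalityI subsetI)
      fix U assume "U \<in> (`) h ` {T. T \<subseteq> {..<N} \<and> card T = j}"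
      then obtain T where T: "T \<subseteq> {..<N}" "card T = j" "U = h ` T" by auto
      then have "card U = j" using card_image inj_on_subset[OF inj] by metis
      then show "U \<in> {T. T \<subseteq> {..<N} \<and> card T = j}" using T im by blast
    next
      fix U assume U: "U \<in> {T. T \<subseteq> {..<N} \<and> card T = j}"
      then obtain T where T: "T \<subseteq> {..<N}" "U = h ` T"
        using im by (metis (no_types, lifting) mem_Collect_eq subset_imageE)
      then have "card T = j" using U card_image inj_on_subset[OF inj] by (metis (mono_tags, lifting) mem_Collect_eq)
      then show "U \<in> (`) h ` {T. T \<subseteq> {..<N} \<and> card T = j}" using T by auto
    qed
  qed
  have "(\<Sum>T | T \<subseteq> {..<N} \<and> card T = j. graph_trans N p r S T)
      = (\<Sum>T | T \<subseteq> {..<N} \<and> card T = j. graph_trans N p r {..<card S} (h ` T))"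
    by (rule sum.cong) (auto intro: step)
  also have "\<dots> = count_trans N p r (card S) j"
    unfolding count_trans_def by (rule sum.reindex_bij_betw[OF bijP])
  finally show ?thesis .
qed

text \<open>
  Transition matrix of the number of present edges, for resampling parameters distributed like the
  random vector \<open>(P, R)\<close> on the probability space \<open>Q\<close>.
\<close>

definition count_kernel ::
    "'b measure \<Rightarrow> ('b \<Rightarrow> real) \<Rightarrow> ('b \<Rightarrow> real) \<Rightarrow> nat \<Rightarrow> nat \<Rightarrow> nat \<Rightarrow> real" where
  "count_kernel Q P R N i j = prob_space.expectation Q (\<lambda>\<omega>. count_trans N (P \<omega>) (R \<omega>) i j)"

definition stationary_count ::
    "'b measure \<Rightarrow> ('b \<Rightarrow> real) \<Rightarrow> ('b \<Rightarrow> real) \<Rightarrow> nat \<Rightarrow> nat pmf \<Rightarrow> bool" where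
  "stationary_count Q P R N \<pi> \<longleftrightarrow>
     set_pmf \<pi> \<subseteq> {..N} \<and>
     (\<forall>j\<le>N. pmf \<pi> j = (\<Sum>i\<le>N. pmf \<pi> i * count_kernel Q P R N i j))"

definition covariance :: "'a measure \<Rightarrow> ('a \<Rightarrow> real) \<Rightarrow> ('a \<Rightarrow> real) \<Rightarrow> real" where
  "covariance M X Y = prob_space.expectation M
     (\<lambda>\<omega>. (X \<omega> - prob_space.expectation M X) * (Y \<omega> - prob_space.expectation M Y))"

text \<open>
  The sigma-algebra generated by the graphs at times \<open>0, \<dots>, m\<close> and the resampling parameters of
  the slots \<open>1, \<dots>, n\<close>.
\<close>

definition history ::
    "'a measure \<Rightarrow> (nat \<Rightarrow> 'a \<Rightarrow> real) \<Rightarrow> (nat \<Rightarrow> 'a \<Rightarrow> real) \<Rightarrow> (nat \<Rightarrow> 'a \<Rightarrow> nat set) \<Rightarrow>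
     nat \<Rightarrow> nat \<Rightarrow> 'a measure" where
  "history M Ps Rs X m n = sigma (space M)
     ({X k -` A \<inter> space M | k A. k \<le> m} \<union>
      {(\<lambda>\<omega>. (Ps k \<omega>, Rs k \<omega>)) -` B \<inter> space M | k B. k \<in> {1..n} \<and> B \<in> sets borel})"

text \<open>
  The process of graphs \<open>X 0, X 1, \<dots>\<close> on the probability space \<open>M\<close>. The parameters of slot
  \<open>m \<ge> 1\<close>, which leads from \<open>X (m - 1)\<close> to \<open>X m\<close>, are \<open>(Ps m, Rs m)\<close>; the values \<open>Ps 0\<close> and
  \<open>Rs 0\<close> play no role. The law of \<open>X 0\<close> is arbitrary. The generic copy \<open>(P, R)\<close> of the parameters
  may live on a different probability space \<open>Q\<close>.
\<close>

locale resampled_graph = M: prob_space M + Q: prob_space Q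
  for M :: "'a measure" and Q :: "'b measure" +
  fixes P R :: "'b \<Rightarrow> real"
    and Ps Rs :: "nat \<Rightarrow> 'a \<Rightarrow> real"
    and X :: "nat \<Rightarrow> 'a \<Rightarrow> nat set"
    and N :: nat
  assumes measurable_generic: "P \<in> borel_measurable Q" "R \<in> borel_measurable Q"
    and generic_range: "\<And>\<omega>. \<omega> \<in> space Q \<Longrightarrow> P \<omega> \<in> {0<..<1} \<and> R \<omega> \<in> {0<..<1}"
    and range: "\<And>m \<omega>. 1 \<le> m \<Longrightarrow> \<omega> \<in> space M \<Longrightarrow> Ps m \<omega> \<in> {0<..<1} \<and> Rs m \<omega> \<in> {0<..<1}"
    and indep: "M.indep_vars (\<lambda>_. borel) (\<lambda>m \<omega>. (Ps m \<omega>, Rs m \<omega>)) {1..}"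
    and identically_distributed: "\<And>m. 1 \<le> m \<Longrightarrow>
          distr M borel (\<lambda>\<omega>. (Ps m \<omega>, Rs m \<omega>)) = distr Q borel (\<lambda>\<omega>. (P \<omega>, R \<omega>))"
    and measurable_graph: "\<And>m. X m \<in> measurable M (count_space (Pow {..<N}))"
    and indep_past: "\<And>m. M.indep_set (sets (history M Ps Rs X m m))
          {(\<lambda>\<omega>. (Ps (Suc m) \<omega>, Rs (Suc m) \<omega>)) -` B \<inter> space M | B. B \<in> sets borel}"
    and transition: "\<And>m T. T \<subseteq> {..<N} \<Longrightarrow>
          AE \<omega> in M. real_cond_exp M (history M Ps Rs X m (Suc m))
              (indicator {\<omega> \<in> space M. X (Suc m) \<omega> = T}) \<omega>
            = graph_trans N (Ps (Suc m) \<omega>) (Rs (Suc m) \<omega>) (X m \<omega>) T"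

end

theory Submission
  imports Defs
begin

text \<open>
  Conditionally on the parameters \<open>(p, r)\<close> of a slot and on the current graph with \<open>i\<close> edges, the
  next graph is a random set with independent members: the \<open>i\<close> present edges are kept with
  probability \<open>r\<close>, the \<open>N - i\<close> absent ones appear with probability \<open>1 - p\<close>. The first two moments
  of its size (\<open>count_trans_mean\<close>, \<open>count_trans_second_moment\<close>) are therefore polynomials in \<open>i\<close> of
  degree one and two. After averaging over \<open>(P, R)\<close>, stationarity turns them into a triangular
  system of two linear equations for \<open>E Y\<close> and \<open>E Y\<^sup>2\<close>. Its diagonal coefficients are
  \<open>E (1 - P) + E (1 - R)\<close> and \<open>1 - E (((1 - P) + (1 - R) - 1)\<^sup>2)\<close>, both positive because the parameters
  lie strictly between \<open>0\<close> and \<open>1\<close>, and solving the system gives the mean and the variance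
  (\<open>moment_equations_solution\<close>).

  The averaged kernel of the count has only positive entries. By Doeblin's contraction argument
  (\<open>l1_contraction\<close>) it has exactly one stationary law, to which the law of the count converges
  from every initial law.

  The hypotheses on the process enter through the joint law of two consecutive graphs only
  (\<open>joint_law_graph\<close>): fresh parameters are independent of the past, so integrating the conditional
  transition probabilities shows that consecutive counts form a step of the averaged kernel.
  The covariance of two consecutive counts is then a finite sum involving the law of the first
  one, and convergence of that law yields the limit (\<open>covariance_count_tendsto\<close>).
\<close>

section \<open>The size of a random set with independent members\<close>

definition independent_edges :: "'e set \<Rightarrow> ('e \<Rightarrow> real) \<Rightarrow> 'e set \<Rightarrow> real" where
  "independent_edges E q T = (\<Prod>e\<in>E. if e \<in> T then q e else 1 - q e)"

lemma sum_prod_if_mem: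
  fixes f g :: "'e \<Rightarrow> real"
  assumes "finite E"
  shows "(\<Sum>T\<in>Pow E. \<Prod>e\<in>E. if e \<in> T then f e else g e) = (\<Prod>e\<in>E. f e + g e)"
  unfolding prod_add[OF assms]
proof (rule sum.cong[OF refl])
  fix T assume "T \<in> Pow E"
  then have "E \<inter> {e. e \<in> T} = T" "E \<inter> - {e. e \<in> T} = E - T" by auto
  then show "(\<Prod>e\<in>E. if e \<in> T then f e else g e) = prod f T * prod g (E - T)"
    by (simp add: prod.If_cases[OF assms])
qed

text \<open>
  Forbidding the sets that miss some member of \<open>A\<close> amounts to replacing the factor \<open>1 - q e\<close>
  by \<open>0\<close> for \<open>e \<in> A\<close>, after which the sum over all subsets still factorises. These inclusion
  probabilities give all moments of the size, whose powers are sums of the indicators of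
  \<open>A \<subseteq> T\<close>.
\<close>

lemma sum_independent_edges_superset:
  assumes E: "finite E" and A: "A \<subseteq> E"
  shows "(\<Sum>T\<in>Pow E. of_bool (A \<subseteq> T) * independent_edges E q T) = prod q A"
proof -
  let ?g = "\<lambda>e. if e \<in> A then 0 else 1 - q e"
  have "(\<Sum>T\<in>Pow E. of_bool (A \<subseteq> T) * independent_edges E q T)
      = (\<Sum>T\<in>Pow E. \<Prod>e\<in>E. if e \<in> T then q e else ?g e)"
  proof (rule sum.cong[OF refl])
    fix T
    show "of_bool (A \<subseteq> T) * independent_edges E q T = (\<Prod>e\<in>E. if e \<in> T then q e else ?g e)"
    proof (cases "A \<subseteq> T")
      case True
      then show ?thesis by (auto simp: independent_edges_def intro!: prod.cong)
    next
      case False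
      then obtain e where "e \<in> A" "e \<notin> T" by auto
      then have "(\<Prod>e\<in>E. if e \<in> T then q e else ?g e) = 0"
        using A E by (intro prod_zero) auto
      then show ?thesis using False by simp
    qed
  qed
  also have "\<dots> = (\<Prod>e\<in>E. if e \<in> A then q e else 1)"
    unfolding sum_prod_if_mem[OF E] by (rule prod.cong) auto
  also have "\<dots> = prod q A"
    using A E by (simp add: prod.If_cases Int_absorb1)
  finally show ?thesis .
qed

lemma independent_edges_total:
  "finite E \<Longrightarrow> (\<Sum>T\<in>Pow E. independent_edges E q T) = 1"
  using sum_independent_edges_superset[of E "{}" q] by simp

lemma real_card_subset:
  assumes "finite E" "T \<subseteq> E"
  shows "real (card T) = (\<Sum>e\<in>E. of_bool (e \<in> T))"
  using assms by (simp add: of_bool_def sum.If_cases Int_absorb1)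

lemma independent_edges_mean:
  assumes E: "finite E"
  shows "(\<Sum>T\<in>Pow E. real (card T) * independent_edges E q T) = sum q E"
proof -
  have "(\<Sum>T\<in>Pow E. real (card T) * independent_edges E q T)
      = (\<Sum>T\<in>Pow E. \<Sum>e\<in>E. of_bool ({e} \<subseteq> T) * independent_edges E q T)"
    by (rule sum.cong) (auto simp: real_card_subset[OF E] sum_distrib_right)
  also have "\<dots> = (\<Sum>e\<in>E. \<Sum>T\<in>Pow E. of_bool ({e} \<subseteq> T) * independent_edges E q T)"
    by (rule sum.swap)
  also have "\<dots> = sum q E"
  proof (rule sum.cong[OF refl])
    fix e assume "e \<in> E"
    then show "(\<Sum>T\<in>Pow E. of_bool ({e} \<subseteq> T) * independent_edges E q T) = q e"
      using sum_independent_edges_superset[OF E, of "{e}" q] by simp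
  qed
  finally show ?thesis .
qed

text \<open>
  The square of the size counts ordered pairs of members. The pairs on the diagonal have inclusion
  probability \<open>q e\<close> rather than \<open>(q e)\<^sup>2\<close>, which accounts for the last two terms.
\<close>

lemma independent_edges_second_moment:
  assumes E: "finite E"
  shows "(\<Sum>T\<in>Pow E. (real (card T))\<^sup>2 * independent_edges E q T)
    = (sum q E)\<^sup>2 + sum q E - (\<Sum>e\<in>E. (q e)\<^sup>2)"
proof -
  have "(\<Sum>T\<in>Pow E. (real (card T))\<^sup>2 * independent_edges E q T)
      = (\<Sum>T\<in>Pow E. \<Sum>e\<in>E. \<Sum>d\<in>E. of_bool ({e, d} \<subseteq> T) * independent_edges E q T)"
  proof (rule sum.cong[OF refl])
    fix T assume "T \<in> Pow E"
    then have "(real (card T))\<^sup>2 = (\<Sum>e\<in>E. \<Sum>d\<in>E. of_bool ({e, d} \<subseteq> T))"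
      by (auto simp: real_card_subset[OF E] power2_eq_square sum_product intro!: sum.cong)
    then show "(real (card T))\<^sup>2 * independent_edges E q T
        = (\<Sum>e\<in>E. \<Sum>d\<in>E. of_bool ({e, d} \<subseteq> T) * independent_edges E q T)"
      by (simp only: sum_distrib_right)
  qed
  also have "\<dots> = (\<Sum>e\<in>E. \<Sum>T\<in>Pow E. \<Sum>d\<in>E. of_bool ({e, d} \<subseteq> T) * independent_edges E q T)"
    by (rule sum.swap)
  also have "\<dots> = (\<Sum>e\<in>E. \<Sum>d\<in>E. \<Sum>T\<in>Pow E. of_bool ({e, d} \<subseteq> T) * independent_edges E q T)"
    by (rule sum.cong[OF refl], rule sum.swap)
  also have "\<dots> = (\<Sum>e\<in>E. \<Sum>d\<in>E. q e * q d + (if d = e then q e - (q e)\<^sup>2 else 0))"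
  proof (intro sum.cong[OF refl])
    fix e d assume "e \<in> E" "d \<in> E"
    then show "(\<Sum>T\<in>Pow E. of_bool ({e, d} \<subseteq> T) * independent_edges E q T)
        = q e * q d + (if d = e then q e - (q e)\<^sup>2 else 0)"
      using sum_independent_edges_superset[OF E, of "{e, d}" q]
      by (cases "d = e") (simp_all add: power2_eq_square)
  qed
  also have "\<dots> = (sum q E)\<^sup>2 + sum q E - (\<Sum>e\<in>E. (q e)\<^sup>2)"
    using E by (simp add: sum.distrib power2_eq_square sum_product sum_subtractf)
  finally show ?thesis .
qed

section \<open>One slot with fixed parameters\<close>

definition present_prob :: "real \<Rightarrow> real \<Rightarrow> 'e set \<Rightarrow> 'e \<Rightarrow> real" where
  "present_prob p r S e = (if e \<in> S then r else 1 - p)"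

text \<open>
  Conditionally on the parameters and on the current graph, the next graph is a random set with
  independent members, so the moments of its size are those computed above.
\<close>

lemma graph_trans_eq_independent_edges:
  "graph_trans N p r S T = independent_edges {..<N} (present_prob p r S) T"
  unfolding graph_trans_def independent_edges_def edge_trans_def present_prob_def
  by (rule prod.cong) auto

lemma graph_trans_pos:
  assumes "p \<in> {0<..<1}" "r \<in> {0<..<1}"
  shows "0 < graph_trans N p r S T"
  unfolding graph_trans_def edge_trans_def using assms by (intro prod_pos) auto

lemma graph_trans_le_1:
  assumes "p \<in> {0<..<1}" "r \<in> {0<..<1}"
  shows "graph_trans N p r S T \<le> 1"
  unfolding graph_trans_def edge_trans_def using assms by (intro prod_le_1) auto

lemma count_trans_sum:
  assumes S: "S \<subseteq> {..<N}"
  shows "(\<Sum>j\<le>N. g j * count_trans N p r (card S) j)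
    = (\<Sum>T\<in>Pow {..<N}. g (card T) * graph_trans N p r S T)"
proof -
  have "card T \<le> N" if "T \<subseteq> {..<N}" for T
    using card_mono[OF _ that] by simp
  then have img: "card ` Pow {..<N} \<subseteq> {..N}" by auto
  have "(\<Sum>T\<in>Pow {..<N}. g (card T) * graph_trans N p r S T)
     = (\<Sum>j\<le>N. \<Sum>T\<in>{T. T \<in> Pow {..<N} \<and> card T = j}. g (card T) * graph_trans N p r S T)"
    by (rule sum.group[symmetric, OF _ _ img]) auto
  also have "\<dots> = (\<Sum>j\<le>N. g j * count_trans N p r (card S) j)"
    unfolding count_trans_eq[OF S, symmetric] sum_distrib_left by (intro sum.cong) auto
  finally show ?thesis by simp
qed

lemma sum_present_prob:
  assumes "i \<le> N"
  shows "(\<Sum>e<N. (present_prob p r {..<i} e) ^ k) = real i * r ^ k + real (N - i) * (1 - p) ^ k"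
proof -
  have "{..<N} \<inter> {e. e < i} = {..<i}" "{..<N} \<inter> - {e. e < i} = {i..<N}" using assms by auto
  then have "(\<Sum>e<N. if e < i then r ^ k else (1 - p) ^ k) = real i * r ^ k + real (N - i) * (1 - p) ^ k"
    by (simp add: sum.If_cases)
  moreover have "(present_prob p r {..<i} e) ^ k = (if e < i then r ^ k else (1 - p) ^ k)" for e
    by (simp add: present_prob_def)
  ultimately show ?thesis by simp
qed

lemma count_trans_total:
  assumes "i \<le> N"
  shows "(\<Sum>j\<le>N. count_trans N p r i j) = 1"
  using count_trans_sum[of "{..<i}" N "\<lambda>_. 1" p r] assms
  by (simp add: graph_trans_eq_independent_edges independent_edges_total)

lemma count_trans_mean:
  assumes "i \<le> N"
  shows "(\<Sum>j\<le>N. real j * count_trans N p r i j) = real i * r + real (N - i) * (1 - p)"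
  using sum_present_prob[OF assms, of p r 1] count_trans_sum[of "{..<i}" N real p r] assms
  by (simp add: graph_trans_eq_independent_edges independent_edges_mean)

lemma count_trans_second_moment:
  assumes "i \<le> N"
  shows "(\<Sum>j\<le>N. (real j)\<^sup>2 * count_trans N p r i j)
    = (real i * r + real (N - i) * (1 - p))\<^sup>2 + (real i * r + real (N - i) * (1 - p))
      - (real i * r\<^sup>2 + real (N - i) * (1 - p)\<^sup>2)"
  using sum_present_prob[OF assms, of p r 1] sum_present_prob[OF assms, of p r 2]
    count_trans_sum[of "{..<i}" N "\<lambda>j. (real j)\<^sup>2" p r] assms
  by (simp add: graph_trans_eq_independent_edges independent_edges_second_moment)

section \<open>Finite chains with positive transition probabilities\<close>

text \<open>
  Doeblin's argument: if \<open>v\<close> has total mass zero, a constant can be subtracted from every entry of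
  \<open>K\<close> without changing \<open>v K\<close>. Subtracting the smallest entry \<open>d > 0\<close> leaves a nonnegative matrix
  whose rows all have sum \<open>1 - |I| d < 1\<close>.
\<close>

lemma l1_contraction:
  fixes K :: "'s \<Rightarrow> 's \<Rightarrow> real"
  assumes I: "finite I" "I \<noteq> {}"
    and pos: "\<And>i j. i \<in> I \<Longrightarrow> j \<in> I \<Longrightarrow> 0 < K i j"
    and total: "\<And>i. i \<in> I \<Longrightarrow> (\<Sum>j\<in>I. K i j) = 1"
  shows "\<exists>q. 0 \<le> q \<and> q < 1 \<and>
    (\<forall>v. (\<Sum>i\<in>I. v i) = 0 \<longrightarrow> (\<Sum>j\<in>I. \<bar>\<Sum>i\<in>I. v i * K i j\<bar>) \<le> q * (\<Sum>i\<in>I. \<bar>v i\<bar>))"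
proof -
  define d where "d = Min ((\<lambda>(i, j). K i j) ` (I \<times> I))"
  have fin: "finite ((\<lambda>(i, j). K i j) ` (I \<times> I))" and ne: "(\<lambda>(i, j). K i j) ` (I \<times> I) \<noteq> {}"
    using I by auto
  have le: "d \<le> K i j" if "i \<in> I" "j \<in> I" for i j
    unfolding d_def using that by (intro Min_le[OF fin]) auto
  have "0 < d"
    unfolding d_def using pos by (subst Min_gr_iff[OF fin ne]) auto
  define q where "q = 1 - real (card I) * d"
  have row: "(\<Sum>j\<in>I. \<bar>K i j - d\<bar>) = q" if "i \<in> I" for i
    using le that total[OF that] by (simp add: q_def sum_subtractf)
  obtain k where "k \<in> I" using I by auto
  then have "0 \<le> q" using row[of k, symmetric] by (simp add: sum_nonneg)
  moreover have "q < 1" using \<open>0 < d\<close> I by (simp add: q_def card_gt_0_iff)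
  moreover have "(\<Sum>j\<in>I. \<bar>\<Sum>i\<in>I. v i * K i j\<bar>) \<le> q * (\<Sum>i\<in>I. \<bar>v i\<bar>)"
    if v: "(\<Sum>i\<in>I. v i) = 0" for v
  proof -
    have "(\<Sum>j\<in>I. \<bar>\<Sum>i\<in>I. v i * K i j\<bar>) = (\<Sum>j\<in>I. \<bar>\<Sum>i\<in>I. v i * (K i j - d)\<bar>)"
      using v by (simp add: right_diff_distrib sum_subtractf flip: sum_distrib_right)
    also have "\<dots> \<le> (\<Sum>j\<in>I. \<Sum>i\<in>I. \<bar>v i\<bar> * \<bar>K i j - d\<bar>)"
      by (intro sum_mono order.trans[OF sum_abs]) (simp add: abs_mult)
    also have "\<dots> = (\<Sum>i\<in>I. \<bar>v i\<bar> * (\<Sum>j\<in>I. \<bar>K i j - d\<bar>))"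
      by (subst sum.swap) (simp add: sum_distrib_left)
    also have "\<dots> = q * (\<Sum>i\<in>I. \<bar>v i\<bar>)"
      by (simp add: row sum_distrib_left mult.commute)
    finally show ?thesis .
  qed
  ultimately show ?thesis by blast
qed

lemma stochastic_sum_preserved:
  fixes K :: "'s \<Rightarrow> 's \<Rightarrow> real"
  assumes "\<And>i. i \<in> I \<Longrightarrow> (\<Sum>j\<in>I. K i j) = 1"
  shows "(\<Sum>j\<in>I. \<Sum>i\<in>I. v i * K i j) = (\<Sum>i\<in>I. v i)"
  using assms by (subst sum.swap) (simp flip: sum_distrib_left)

lemma l1_geometric_decay:
  fixes K :: "'s \<Rightarrow> 's \<Rightarrow> real"
  assumes "finite I" "I \<noteq> {}"
    and "\<And>i j. i \<in> I \<Longrightarrow> j \<in> I \<Longrightarrow> 0 < K i j"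
    and total: "\<And>i. i \<in> I \<Longrightarrow> (\<Sum>j\<in>I. K i j) = 1"
    and step: "\<And>n j. j \<in> I \<Longrightarrow> v (Suc n) j = (\<Sum>i\<in>I. v n i * K i j)"
    and zero: "(\<Sum>i\<in>I. v 0 i) = 0"
  shows "\<exists>q C. 0 \<le> q \<and> q < 1 \<and> (\<forall>n. \<forall>j\<in>I. \<bar>v n j\<bar> \<le> C * q ^ n)"
proof -
  obtain q where "0 \<le> q \<and> q < 1 \<and>
    (\<forall>v. (\<Sum>i\<in>I. v i) = 0 \<longrightarrow> (\<Sum>j\<in>I. \<bar>\<Sum>i\<in>I. v i * K i j\<bar>) \<le> q * (\<Sum>i\<in>I. \<bar>v i\<bar>))"
    using l1_contraction[OF assms(1-4)] ..
  then have q: "0 \<le> q" "q < 1"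
    and contr: "\<And>v. (\<Sum>i\<in>I. v i) = 0 \<Longrightarrow> (\<Sum>j\<in>I. \<bar>\<Sum>i\<in>I. v i * K i j\<bar>) \<le> q * (\<Sum>i\<in>I. \<bar>v i\<bar>)"
    by simp_all
  have "(\<Sum>i\<in>I. v n i) = 0 \<and> (\<Sum>i\<in>I. \<bar>v n i\<bar>) \<le> (\<Sum>i\<in>I. \<bar>v 0 i\<bar>) * q ^ n" for n
  proof (induction n)
    case (Suc n)
    have "(\<Sum>i\<in>I. \<bar>v (Suc n) i\<bar>) \<le> q * (\<Sum>i\<in>I. \<bar>v n i\<bar>)"
      using contr[of "v n"] Suc step by simp
    also have "\<dots> \<le> q * ((\<Sum>i\<in>I. \<bar>v 0 i\<bar>) * q ^ n)"
      using Suc q by (intro mult_left_mono) auto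
    finally show ?case
      using Suc step stochastic_sum_preserved[where I=I and K=K and v="v n"] total by (simp add: mult_ac)
  qed (use zero in simp)
  then have "\<bar>v n j\<bar> \<le> (\<Sum>i\<in>I. \<bar>v 0 i\<bar>) * q ^ n" if "j \<in> I" for n j
    using that assms(1) by (intro order.trans[OF member_le_sum[of j I "\<lambda>i. \<bar>v n i\<bar>"]]) auto
  then show ?thesis using q by blast
qed

lemma positive_chain_tendsto_stationary:
  fixes K :: "'s \<Rightarrow> 's \<Rightarrow> real"
  assumes "finite I" "I \<noteq> {}"
    and "\<And>i j. i \<in> I \<Longrightarrow> j \<in> I \<Longrightarrow> 0 < K i j"
    and total: "\<And>i. i \<in> I \<Longrightarrow> (\<Sum>j\<in>I. K i j) = 1"
    and step: "\<And>n j. j \<in> I \<Longrightarrow> \<mu> (Suc n) j = (\<Sum>i\<in>I. \<mu> n i * K i j)"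
    and stat: "\<And>j. j \<in> I \<Longrightarrow> \<nu> j = (\<Sum>i\<in>I. \<nu> i * K i j)"
    and mass: "(\<Sum>i\<in>I. \<mu> 0 i) = (\<Sum>i\<in>I. \<nu> i)"
    and j: "j \<in> I"
  shows "(\<lambda>n. \<mu> n j) \<longlonglongrightarrow> \<nu> j"
proof -
  have step': "\<mu> (Suc n) j - \<nu> j = (\<Sum>i\<in>I. (\<mu> n i - \<nu> i) * K i j)" if "j \<in> I" for n j
    by (subst stat[OF that]) (simp add: step[OF that] left_diff_distrib sum_subtractf)
  have zero: "(\<Sum>i\<in>I. \<mu> 0 i - \<nu> i) = 0" using mass by (simp add: sum_subtractf)
  have "\<exists>q C. 0 \<le> q \<and> q < 1 \<and> (\<forall>n. \<forall>j\<in>I. \<bar>\<mu> n j - \<nu> j\<bar> \<le> C * q ^ n)"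
    by (rule l1_geometric_decay[where I=I and K=K]) (fact assms(1-4) | rule step' zero | assumption)+
  then obtain q C where q: "0 \<le> q" "q < 1" and
    bound: "\<And>n j. j \<in> I \<Longrightarrow> \<bar>\<mu> n j - \<nu> j\<bar> \<le> C * q ^ n"
    by blast
  have "(\<lambda>n. \<mu> n j - \<nu> j) \<longlonglongrightarrow> 0"
  proof (rule Lim_null_comparison)
    show "\<forall>\<^sub>F n in sequentially. norm (\<mu> n j - \<nu> j) \<le> C * q ^ n"
      using bound[OF j] by simp
    show "(\<lambda>n. C * q ^ n) \<longlonglongrightarrow> 0"
      using q by (intro tendsto_mult_right_zero LIMSEQ_realpow_zero)
  qed
  then show ?thesis by (simp add: LIM_zero_iff)
qed

text \<open>
  The iterates of the uniform distribution converge because their increments have total mass zero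
  and therefore decay geometrically; the limit is a fixed point by continuity.
\<close>

lemma positive_chain_stationary_exists:
  fixes K :: "'s \<Rightarrow> 's \<Rightarrow> real"
  assumes I: "finite I" "I \<noteq> {}"
    and pos: "\<And>i j. i \<in> I \<Longrightarrow> j \<in> I \<Longrightarrow> 0 < K i j"
    and total: "\<And>i. i \<in> I \<Longrightarrow> (\<Sum>j\<in>I. K i j) = 1"
  obtains \<nu> where "\<And>j. j \<in> I \<Longrightarrow> 0 \<le> \<nu> j" "(\<Sum>j\<in>I. \<nu> j) = 1"
    "\<And>j. j \<in> I \<Longrightarrow> \<nu> j = (\<Sum>i\<in>I. \<nu> i * K i j)"
proof -
  define \<mu> where "\<mu> n = ((\<lambda>v j. \<Sum>i\<in>I. v i * K i j) ^^ n) (\<lambda>_. 1 / real (card I))" for n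
  have step: "\<mu> (Suc n) j = (\<Sum>i\<in>I. \<mu> n i * K i j)" for n j
    by (simp add: \<mu>_def)
  have mass: "(\<Sum>j\<in>I. \<mu> n j) = 1" for n
    by (induction n) (use I in \<open>simp_all add: \<mu>_def stochastic_sum_preserved[OF total]\<close>)
  have nonneg: "j \<in> I \<Longrightarrow> 0 \<le> \<mu> n j" for n j
    by (induction n arbitrary: j) (auto simp: \<mu>_def intro!: sum_nonneg mult_nonneg_nonneg less_imp_le[OF pos])
  have step': "\<And>n j. \<mu> (Suc (Suc n)) j - \<mu> (Suc n) j = (\<Sum>i\<in>I. (\<mu> (Suc n) i - \<mu> n i) * K i j)"
    unfolding step by (simp add: left_diff_distrib sum_subtractf)
  have zero: "(\<Sum>i\<in>I. \<mu> (Suc 0) i - \<mu> 0 i) = 0" using mass by (simp add: sum_subtractf)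
  have "\<exists>q C. 0 \<le> q \<and> q < 1 \<and> (\<forall>n. \<forall>j\<in>I. \<bar>\<mu> (Suc n) j - \<mu> n j\<bar> \<le> C * q ^ n)"
    by (rule l1_geometric_decay[where I=I and K=K]) (fact assms(1-4) | rule step' zero | assumption)+
  then obtain q C where q: "0 \<le> q" "q < 1" and
    bound: "\<And>n j. j \<in> I \<Longrightarrow> \<bar>\<mu> (Suc n) j - \<mu> n j\<bar> \<le> C * q ^ n"
    by blast
  have conv: "convergent (\<lambda>n. \<mu> n j)" if j: "j \<in> I" for j
  proof -
    have "summable (\<lambda>n. \<mu> (Suc n) j - \<mu> n j)"
    proof (rule summable_comparison_test')
      show "summable (\<lambda>n. C * q ^ n)"
        using q by (intro summable_mult summable_geometric) simp
      show "norm (\<mu> (Suc n) j - \<mu> n j) \<le> C * q ^ n" if "n \<ge> 0" for n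
        using bound[OF j] by simp
    qed
    then have "convergent (\<lambda>n. \<Sum>k<n. \<mu> (Suc k) j - \<mu> k j)"
      by (simp add: summable_iff_convergent)
    then have "convergent (\<lambda>n. \<mu> n j - \<mu> 0 j)" 
      by (simp only: sum_lessThan_telescope[of "\<lambda>n. \<mu> n j"])
    from convergent_add[OF this convergent_const[of "\<mu> 0 j"]] show ?thesis by simp
  qed
  define \<nu> where "\<nu> j = lim (\<lambda>n. \<mu> n j)" for j
  have lim: "(\<lambda>n. \<mu> n j) \<longlonglongrightarrow> \<nu> j" if "j \<in> I" for j
    using conv[OF that] by (simp add: \<nu>_def convergent_LIMSEQ_iff)
  have "0 \<le> \<nu> j" if "j \<in> I" for j
    by (rule LIMSEQ_le_const[OF lim[OF that]]) (use nonneg[OF that] in auto)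
  moreover have "(\<Sum>j\<in>I. \<nu> j) = 1"
  proof -
    have "(\<lambda>n. \<Sum>j\<in>I. \<mu> n j) \<longlonglongrightarrow> (\<Sum>j\<in>I. \<nu> j)" by (intro tendsto_sum lim)
    then show ?thesis using mass by (simp add: LIMSEQ_const_iff)
  qed
  moreover have "\<nu> j = (\<Sum>i\<in>I. \<nu> i * K i j)" if "j \<in> I" for j
  proof (rule LIMSEQ_unique)
    show "(\<lambda>n. \<mu> (Suc n) j) \<longlonglongrightarrow> \<nu> j" using lim[OF that] by (rule LIMSEQ_Suc)
    show "(\<lambda>n. \<mu> (Suc n) j) \<longlonglongrightarrow> (\<Sum>i\<in>I. \<nu> i * K i j)"
      unfolding step by (intro tendsto_sum tendsto_mult_right lim)
  qed
  ultimately show ?thesis by (rule that)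
qed

section \<open>Averaging over the parameters\<close>

locale resampling_parameters = prob_space Q
  for Q :: "'b measure" +
  fixes P R :: "'b \<Rightarrow> real"
  assumes measurable_parameters [measurable]: "P \<in> borel_measurable Q" "R \<in> borel_measurable Q"
    and parameters_range: "\<And>\<omega>. \<omega> \<in> space Q \<Longrightarrow> P \<omega> \<in> {0<..<1} \<and> R \<omega> \<in> {0<..<1}"
begin

lemma expectation_pos:
  fixes f :: "'b \<Rightarrow> real"
  assumes "integrable Q f" "\<And>\<omega>. \<omega> \<in> space Q \<Longrightarrow> 0 < f \<omega>"
  shows "0 < expectation f"
  using integral_less_AE_space[of "\<lambda>_. 0" f] assms by (simp add: emeasure_space_1)

lemma integrable_graph_trans: "integrable Q (\<lambda>\<omega>. graph_trans N (P \<omega>) (R \<omega>) S T)"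
proof (rule integrable_const_bound[where B = 1])
  show "(\<lambda>\<omega>. graph_trans N (P \<omega>) (R \<omega>) S T) \<in> borel_measurable Q"
    unfolding graph_trans_def edge_trans_def by measurable
  show "AE \<omega> in Q. norm (graph_trans N (P \<omega>) (R \<omega>) S T) \<le> 1"
    using parameters_range graph_trans_pos graph_trans_le_1
    by (intro AE_I2) (simp add: less_imp_le)
qed

lemma integrable_count_trans: "integrable Q (\<lambda>\<omega>. count_trans N (P \<omega>) (R \<omega>) i j)"
  unfolding count_trans_def by (intro Bochner_Integration.integrable_sum integrable_graph_trans)

lemma sum_count_kernel:
  "(\<Sum>j\<le>N. g j * count_kernel Q P R N i j)
    = expectation (\<lambda>\<omega>. \<Sum>j\<le>N. g j * count_trans N (P \<omega>) (R \<omega>) i j)"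
  by (simp add: count_kernel_def integrable_count_trans)

lemma count_kernel_pos:
  assumes "j \<le> N"
  shows "0 < count_kernel Q P R N i j"
  unfolding count_kernel_def
proof (rule expectation_pos[OF integrable_count_trans])
  fix \<omega> assume "\<omega> \<in> space Q"
  then show "0 < count_trans N (P \<omega>) (R \<omega>) i j"
    unfolding count_trans_def
  proof (intro sum_pos graph_trans_pos)
    have "{..<j} \<in> {T. T \<subseteq> {..<N} \<and> card T = j}" using assms by auto
    then show "{T. T \<subseteq> {..<N} \<and> card T = j} \<noteq> {}" by blast
  qed (use parameters_range in auto)
qed

lemma count_kernel_total:
  assumes "i \<le> N"
  shows "(\<Sum>j\<le>N. count_kernel Q P R N i j) = 1"
  using sum_count_kernel[where g="\<lambda>_. 1"] assms by (simp add: count_trans_total prob_space)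

lemma sum_expected_graph_trans:
  assumes "S \<subseteq> {..<N}"
  shows "(\<Sum>T\<in>Pow {..<N}. h (card T) * expectation (\<lambda>\<omega>. graph_trans N (P \<omega>) (R \<omega>) S T))
    = (\<Sum>j\<le>N. h j * count_kernel Q P R N (card S) j)"
  unfolding sum_count_kernel count_trans_sum[OF assms]
  by (simp add: integrable_graph_trans)

lemma integrable_absent:
  "integrable Q (\<lambda>\<omega>. (1 - P \<omega>) ^ k * (1 - R \<omega>) ^ l)"
proof (rule integrable_const_bound[where B = 1])
  show "AE \<omega> in Q. norm ((1 - P \<omega>) ^ k * (1 - R \<omega>) ^ l) \<le> 1"
  proof (rule AE_I2)
    fix \<omega> assume "\<omega> \<in> space Q"
    from parameters_range[OF this] show "norm ((1 - P \<omega>) ^ k * (1 - R \<omega>) ^ l) \<le> 1"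
      by (auto simp: abs_mult intro!: mult_le_one power_le_one)
  qed
qed measurable

text \<open>
  Both conditional moments of the next edge count are polynomials of degree at most two in the
  resampling probabilities \<open>1 - P\<close> and \<open>1 - R\<close>; averaging them needs no more than the
  five expectations on the right.
\<close>

lemma expectation_quadratic:
  "expectation (\<lambda>\<omega>. c + c\<^sub>P * (1 - P \<omega>) + c\<^sub>R * (1 - R \<omega>)
      + c\<^sub>P\<^sub>P * (1 - P \<omega>)\<^sup>2 + c\<^sub>P\<^sub>R * ((1 - P \<omega>) * (1 - R \<omega>)) + c\<^sub>R\<^sub>R * (1 - R \<omega>)\<^sup>2)
    = c + c\<^sub>P * expectation (\<lambda>\<omega>. 1 - P \<omega>) + c\<^sub>R * expectation (\<lambda>\<omega>. 1 - R \<omega>)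
      + c\<^sub>P\<^sub>P * expectation (\<lambda>\<omega>. (1 - P \<omega>)\<^sup>2) + c\<^sub>P\<^sub>R * expectation (\<lambda>\<omega>. (1 - P \<omega>) * (1 - R \<omega>))
      + c\<^sub>R\<^sub>R * expectation (\<lambda>\<omega>. (1 - R \<omega>)\<^sup>2)"
proof -
  have [simp]: "integrable Q (\<lambda>\<omega>. 1 - P \<omega>)" "integrable Q (\<lambda>\<omega>. 1 - R \<omega>)"
    "integrable Q (\<lambda>\<omega>. (1 - P \<omega>)\<^sup>2)" "integrable Q (\<lambda>\<omega>. (1 - P \<omega>) * (1 - R \<omega>))"
    "integrable Q (\<lambda>\<omega>. (1 - R \<omega>)\<^sup>2)"
    using integrable_absent[of 1 0] integrable_absent[of 0 1] integrable_absent[of 2 0]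
      integrable_absent[of 1 1] integrable_absent[of 0 2] by simp_all
  show ?thesis
    by (simp add: prob_space del: Bochner_Integration.integral_diff Bochner_Integration.integrable_diff)
qed

lemma expectation_parameters:
  "expectation P = 1 - expectation (\<lambda>\<omega>. 1 - P \<omega>)"
  "expectation R = 1 - expectation (\<lambda>\<omega>. 1 - R \<omega>)"
  using expectation_quadratic[of 1 "-1" 0 0 0 0] expectation_quadratic[of 1 0 "-1" 0 0 0] by simp_all

lemma count_kernel_mean:
  assumes "i \<le> N"
  shows "(\<Sum>j\<le>N. real j * count_kernel Q P R N i j)
    = real N * expectation (\<lambda>\<omega>. 1 - P \<omega>)
      + (1 - expectation (\<lambda>\<omega>. 1 - P \<omega>) - expectation (\<lambda>\<omega>. 1 - R \<omega>)) * real i"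
proof -
  have "(\<Sum>j\<le>N. real j * count_kernel Q P R N i j)
      = real i + real (N - i) * expectation (\<lambda>\<omega>. 1 - P \<omega>) + (- real i) * expectation (\<lambda>\<omega>. 1 - R \<omega>)"
    unfolding sum_count_kernel count_trans_mean[OF assms]
    using expectation_quadratic[of "real i" "real (N - i)" "- real i" 0 0 0]
    by (simp add: algebra_simps)
  then show ?thesis using assms by (simp add: of_nat_diff algebra_simps)
qed

lemma count_kernel_second_moment:
  assumes "i \<le> N"
  defines "k \<equiv> real (N - i)"
  shows "(\<Sum>j\<le>N. (real j)\<^sup>2 * count_kernel Q P R N i j)
    = (real i)\<^sup>2 + (2 * real i * k + k) * expectation (\<lambda>\<omega>. 1 - P \<omega>)
      + (real i - 2 * (real i)\<^sup>2) * expectation (\<lambda>\<omega>. 1 - R \<omega>)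
      + (k\<^sup>2 - k) * expectation (\<lambda>\<omega>. (1 - P \<omega>)\<^sup>2)
      + (- 2 * real i * k) * expectation (\<lambda>\<omega>. (1 - P \<omega>) * (1 - R \<omega>))
      + ((real i)\<^sup>2 - real i) * expectation (\<lambda>\<omega>. (1 - R \<omega>)\<^sup>2)"
  unfolding sum_count_kernel count_trans_second_moment[OF assms(1)] k_def[symmetric]
    expectation_quadratic[symmetric]
  by (rule arg_cong[where f=expectation], rule ext) (simp add: power2_eq_square algebra_simps)

section \<open>Stationary edge counts\<close>

lemma stationary_count_expectation:
  assumes "stationary_count Q P R N \<pi>"
  shows "measure_pmf.expectation \<pi> g = (\<Sum>j\<le>N. g j * pmf \<pi> j)"
  by (rule integral_measure_pmf_real) (use assms in \<open>auto simp: stationary_count_def\<close>)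

lemma stationary_count_total:
  assumes "stationary_count Q P R N \<pi>"
  shows "(\<Sum>j\<le>N. pmf \<pi> j) = 1"
  using stationary_count_expectation[OF assms, of "\<lambda>_. 1"] by simp

text \<open>
  Stationarity tested against a function \<open>g\<close>: taking \<open>g\<close> to be a power turns it into a linear
  equation between the moments.
\<close>

lemma stationary_count_invariant:
  assumes st: "stationary_count Q P R N \<pi>"
  shows "(\<Sum>j\<le>N. g j * pmf \<pi> j)
    = (\<Sum>i\<le>N. pmf \<pi> i * (\<Sum>j\<le>N. g j * count_kernel Q P R N i j))"
proof -
  have "(\<Sum>j\<le>N. g j * pmf \<pi> j) = (\<Sum>j\<le>N. \<Sum>i\<le>N. pmf \<pi> i * (g j * count_kernel Q P R N i j))"
  proof (rule sum.cong[OF refl])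
    fix j assume "j \<in> {..N}"
    then have "pmf \<pi> j = (\<Sum>i\<le>N. pmf \<pi> i * count_kernel Q P R N i j)"
      using st by (simp add: stationary_count_def)
    then show "g j * pmf \<pi> j = (\<Sum>i\<le>N. pmf \<pi> i * (g j * count_kernel Q P R N i j))"
      by (simp add: sum_distrib_left mult_ac)
  qed
  also have "\<dots> = (\<Sum>i\<le>N. \<Sum>j\<le>N. pmf \<pi> i * (g j * count_kernel Q P R N i j))"
    by (rule sum.swap)
  finally show ?thesis by (simp add: sum_distrib_left)
qed

lemma count_chain_tendsto:
  assumes st: "stationary_count Q P R N \<pi>"
    and step: "\<And>n j. j \<le> N \<Longrightarrow> \<mu> (Suc n) j = (\<Sum>i\<le>N. \<mu> n i * count_kernel Q P R N i j)"
    and mass: "(\<Sum>i\<le>N. \<mu> 0 i) = 1" and j: "j \<le> N"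
  shows "(\<lambda>n. \<mu> n j) \<longlonglongrightarrow> pmf \<pi> j"
proof (rule positive_chain_tendsto_stationary[where I="{..N}" and K="count_kernel Q P R N"])
  show "(\<Sum>i\<le>N. \<mu> 0 i) = (\<Sum>i\<le>N. pmf \<pi> i)"
    using mass stationary_count_total[OF st] by simp
qed (use st step j in \<open>auto simp: stationary_count_def count_kernel_pos count_kernel_total\<close>)

lemma stationary_count_unique_existence: "\<exists>!\<pi>. stationary_count Q P R N \<pi>"
proof (rule ex_ex1I)
  obtain \<nu> where nonneg: "\<And>j. j \<in> {..N} \<Longrightarrow> 0 \<le> \<nu> j" and total: "(\<Sum>j\<le>N. \<nu> j) = 1"
    and inv: "\<And>j. j \<in> {..N} \<Longrightarrow> \<nu> j = (\<Sum>i\<le>N. \<nu> i * count_kernel Q P R N i j)"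
    by (rule positive_chain_stationary_exists[of "{..N}" "count_kernel Q P R N"])
      (auto simp: count_kernel_pos count_kernel_total)
  define f where "f j = (if j \<le> N then \<nu> j else 0)" for j
  have f: "0 \<le> f j" for j using nonneg by (simp add: f_def)
  have "(\<integral>\<^sup>+j. ennreal (f j) \<partial>count_space UNIV) = (\<Sum>j\<le>N. ennreal (f j))"
    by (rule nn_integral_count_space') (auto simp: f_def)
  also have "\<dots> = ennreal (\<Sum>j\<le>N. f j)"
    using f by (simp add: sum_ennreal)
  also have "\<dots> = 1" using total by (simp add: f_def)
  finally have mass: "(\<integral>\<^sup>+j. ennreal (f j) \<partial>count_space UNIV) = 1" .
  have pmf: "pmf (embed_pmf f) j = f j" for j
    by (rule pmf_embed_pmf[OF f mass])
  have "stationary_count Q P R N (embed_pmf f)"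
    unfolding stationary_count_def
  proof
    show "set_pmf (embed_pmf f) \<subseteq> {..N}"
      by (auto simp: set_pmf_iff pmf f_def split: if_splits)
    show "\<forall>j\<le>N. pmf (embed_pmf f) j = (\<Sum>i\<le>N. pmf (embed_pmf f) i * count_kernel Q P R N i j)"
      using inv by (simp add: pmf f_def)
  qed
  then show "\<exists>\<pi>. stationary_count Q P R N \<pi>" ..
next
  fix \<pi> \<rho> assume pi: "stationary_count Q P R N \<pi>" and rho: "stationary_count Q P R N \<rho>"
  show "\<pi> = \<rho>"
  proof (rule pmf_eqI)
    fix j
    show "pmf \<pi> j = pmf \<rho> j"
    proof (cases "j \<le> N")
      case True
      \<comment> \<open>A stationary law, seen as a constant sequence, is attracted by every other one.\<close>
      have "(\<lambda>n :: nat. pmf \<rho> j) \<longlonglongrightarrow> pmf \<pi> j"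
        using count_chain_tendsto[OF pi, of "\<lambda>_. pmf \<rho>" j] stationary_count_total[OF rho] rho True
        by (simp add: stationary_count_def)
      then show ?thesis by (simp add: LIMSEQ_const_iff)
    next
      case False
      then have "j \<notin> set_pmf \<pi>" "j \<notin> set_pmf \<rho>"
        using pi rho by (auto simp: stationary_count_def)
      then show ?thesis by (simp add: set_pmf_iff)
    qed
  qed
qed

lemma stationary_count_quadratic:
  assumes "stationary_count Q P R N \<pi>"
  shows "(\<Sum>i\<le>N. pmf \<pi> i * (c + c\<^sub>1 * real i + c\<^sub>2 * (real i)\<^sup>2))
    = c + c\<^sub>1 * measure_pmf.expectation \<pi> real + c\<^sub>2 * measure_pmf.expectation \<pi> (\<lambda>y. (real y)\<^sup>2)"
proof -
  have "(\<Sum>i\<le>N. pmf \<pi> i * (c + c\<^sub>1 * real i + c\<^sub>2 * (real i)\<^sup>2))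
      = c * (\<Sum>i\<le>N. pmf \<pi> i) + c\<^sub>1 * (\<Sum>i\<le>N. real i * pmf \<pi> i) + c\<^sub>2 * (\<Sum>i\<le>N. (real i)\<^sup>2 * pmf \<pi> i)"
    unfolding sum_distrib_left sum.distrib[symmetric]
    by (rule sum.cong) (simp_all add: algebra_simps)
  then show ?thesis
    by (simp add: stationary_count_total[OF assms] stationary_count_expectation[OF assms])
qed

lemma stationary_mean_equation:
  assumes st: "stationary_count Q P R N \<pi>"
  shows "measure_pmf.expectation \<pi> real
    = (1 - expectation (\<lambda>\<omega>. 1 - P \<omega>) - expectation (\<lambda>\<omega>. 1 - R \<omega>)) * measure_pmf.expectation \<pi> real
      + real N * expectation (\<lambda>\<omega>. 1 - P \<omega>)"
proof -
  let ?a = "expectation (\<lambda>\<omega>. 1 - P \<omega>)" and ?b = "expectation (\<lambda>\<omega>. 1 - R \<omega>)"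
  have "measure_pmf.expectation \<pi> real
      = (\<Sum>i\<le>N. pmf \<pi> i * (\<Sum>j\<le>N. real j * count_kernel Q P R N i j))"
    unfolding stationary_count_expectation[OF st] by (rule stationary_count_invariant[OF st])
  also have "\<dots> = (\<Sum>i\<le>N. pmf \<pi> i * (real N * ?a + (1 - ?a - ?b) * real i + 0 * (real i)\<^sup>2))"
    by (rule sum.cong) (simp_all add: count_kernel_mean)
  finally show ?thesis
    unfolding stationary_count_quadratic[OF st] by simp
qed

text \<open>
  The shape of the right-hand side mirrors that of the second moment of one transition: averaging
  over the law of the count replaces \<open>i\<close>, \<open>i (N - i)\<close> and \<open>(N - i)\<^sup>2\<close> by their expectations.
\<close>

lemma stationary_second_moment_equation:
  assumes st: "stationary_count Q P R N \<pi>"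
  defines "m\<^sub>1 \<equiv> measure_pmf.expectation \<pi> real"
    and "m\<^sub>2 \<equiv> measure_pmf.expectation \<pi> (\<lambda>y. (real y)\<^sup>2)"
  shows "m\<^sub>2 = m\<^sub>2
      + (2 * (real N * m\<^sub>1 - m\<^sub>2) + (real N - m\<^sub>1)) * expectation (\<lambda>\<omega>. 1 - P \<omega>)
      + (m\<^sub>1 - 2 * m\<^sub>2) * expectation (\<lambda>\<omega>. 1 - R \<omega>)
      + (((real N)\<^sup>2 - 2 * real N * m\<^sub>1 + m\<^sub>2) - (real N - m\<^sub>1)) * expectation (\<lambda>\<omega>. (1 - P \<omega>)\<^sup>2)
      + (- 2 * (real N * m\<^sub>1 - m\<^sub>2)) * expectation (\<lambda>\<omega>. (1 - P \<omega>) * (1 - R \<omega>))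
      + (m\<^sub>2 - m\<^sub>1) * expectation (\<lambda>\<omega>. (1 - R \<omega>)\<^sup>2)"
proof -
  let ?n = "real N"
  let ?a = "expectation (\<lambda>\<omega>. 1 - P \<omega>)" and ?b = "expectation (\<lambda>\<omega>. 1 - R \<omega>)"
  let ?A = "expectation (\<lambda>\<omega>. (1 - P \<omega>)\<^sup>2)" and ?B = "expectation (\<lambda>\<omega>. (1 - R \<omega>)\<^sup>2)"
  let ?C = "expectation (\<lambda>\<omega>. (1 - P \<omega>) * (1 - R \<omega>))"
  \<comment> \<open>An identity of real variables: normalising with the integrals in place of the variables would
    also rewrite the integrands.\<close>
  have collect: "x\<^sup>2 + (2 * x * (n - x) + (n - x)) * a + (x - 2 * x\<^sup>2) * b
      + ((n - x)\<^sup>2 - (n - x)) * A + (- 2 * x * (n - x)) * C + (x\<^sup>2 - x) * B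
      = (n * a + (n\<^sup>2 - n) * A) + (2 * n * a - a + b - 2 * n * A + A - 2 * n * C - B) * x
        + (1 - 2 * a - 2 * b + A + 2 * C + B) * x\<^sup>2" for n x a b A B C :: real
    by algebra
  have "m\<^sub>2 = (\<Sum>i\<le>N. pmf \<pi> i * (\<Sum>j\<le>N. (real j)\<^sup>2 * count_kernel Q P R N i j))"
    unfolding m\<^sub>2_def stationary_count_expectation[OF st] by (rule stationary_count_invariant[OF st])
  also have "\<dots> = (\<Sum>i\<le>N. pmf \<pi> i * ((?n * ?a + (?n\<^sup>2 - ?n) * ?A)
      + (2 * ?n * ?a - ?a + ?b - 2 * ?n * ?A + ?A - 2 * ?n * ?C - ?B) * real i
      + (1 - 2 * ?a - 2 * ?b + ?A + 2 * ?C + ?B) * (real i)\<^sup>2))"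
    by (rule sum.cong) (simp_all only: count_kernel_second_moment of_nat_diff atMost_iff collect)
  also have "\<dots> = (?n * ?a + (?n\<^sup>2 - ?n) * ?A)
      + (2 * ?n * ?a - ?a + ?b - 2 * ?n * ?A + ?A - 2 * ?n * ?C - ?B) * m\<^sub>1
      + (1 - 2 * ?a - 2 * ?b + ?A + 2 * ?C + ?B) * m\<^sub>2"
    unfolding stationary_count_quadratic[OF st] m\<^sub>1_def m\<^sub>2_def ..
  finally show ?thesis by algebra
qed

text \<open>
  This quantity is the factor by which one averaged transition multiplies the quadratic term of a
  function of the count, that is, the eigenvalue belonging to quadratic functions. It lies below
  \<open>1\<close>, so the equation for the second moment has exactly one solution.
\<close>

lemma expectation_contraction_factor:
  "expectation (\<lambda>\<omega>. ((1 - P \<omega>) + (1 - R \<omega>) - 1)\<^sup>2)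
    = expectation (\<lambda>\<omega>. (1 - P \<omega>)\<^sup>2) + 2 * expectation (\<lambda>\<omega>. (1 - P \<omega>) * (1 - R \<omega>))
      + expectation (\<lambda>\<omega>. (1 - R \<omega>)\<^sup>2)
      - 2 * expectation (\<lambda>\<omega>. 1 - P \<omega>) - 2 * expectation (\<lambda>\<omega>. 1 - R \<omega>) + 1"
proof -
  have "expectation (\<lambda>\<omega>. ((1 - P \<omega>) + (1 - R \<omega>) - 1)\<^sup>2)
      = expectation (\<lambda>\<omega>. 1 + (- 2) * (1 - P \<omega>) + (- 2) * (1 - R \<omega>)
        + 1 * (1 - P \<omega>)\<^sup>2 + 2 * ((1 - P \<omega>) * (1 - R \<omega>)) + 1 * (1 - R \<omega>)\<^sup>2)"
    by (rule arg_cong[where f = expectation], rule ext) (simp add: power2_eq_square algebra_simps)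
  then show ?thesis unfolding expectation_quadratic by simp
qed

lemma expectation_contraction_factor_less_1:
  "expectation (\<lambda>\<omega>. ((1 - P \<omega>) + (1 - R \<omega>) - 1)\<^sup>2) < 1"
proof -
  have bound: "((1 - P \<omega>) + (1 - R \<omega>) - 1)\<^sup>2 < 1" if "\<omega> \<in> space Q" for \<omega>
    using parameters_range[OF that] by (auto simp: abs_square_less_1 abs_less_iff)
  have int: "integrable Q (\<lambda>\<omega>. ((1 - P \<omega>) + (1 - R \<omega>) - 1)\<^sup>2)"
  proof (rule integrable_const_bound[where B = 1])
    show "AE \<omega> in Q. norm (((1 - P \<omega>) + (1 - R \<omega>) - 1)\<^sup>2) \<le> 1"
      using bound by (intro AE_I2) (simp add: less_imp_le)
  qed measurable
  have "0 < expectation (\<lambda>\<omega>. 1 - ((1 - P \<omega>) + (1 - R \<omega>) - 1)\<^sup>2)"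
    by (rule expectation_pos) (use int bound in auto)
  then show ?thesis using int by (simp add: prob_space)
qed

lemma expectation_absent_pos:
  "0 < expectation (\<lambda>\<omega>. 1 - P \<omega>)" "0 < expectation (\<lambda>\<omega>. 1 - R \<omega>)"
  using integrable_absent[of 1 0] integrable_absent[of 0 1] parameters_range
  by (auto intro!: expectation_pos)

lemma stationary_variance:
  assumes "stationary_count Q P R N \<pi>"
  shows "measure_pmf.variance \<pi> real
    = measure_pmf.expectation \<pi> (\<lambda>y. (real y)\<^sup>2) - (measure_pmf.expectation \<pi> real)\<^sup>2"
proof -
  have "finite (set_pmf \<pi>)"
    using assms finite_subset by (auto simp: stationary_count_def)
  then show ?thesis
    by (intro measure_pmf.variance_eq integrable_measure_pmf_finite)
qed

end

text \<open>
  The equations for the first two moments of a stationary count determine them: the first one gives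
  \<open>m\<^sub>1\<close> because \<open>a + b\<close> is positive, and the positive quantity in the second hypothesis is what
  multiplies \<open>m\<^sub>2\<close> once its terms are collected in the second equation. Here \<open>a, b\<close> stand for the
  means of \<open>1 - P\<close> and \<open>1 - R\<close>, \<open>A, B\<close> for their second moments, \<open>C\<close> for their mixed moment and
  \<open>n\<close> for the number of edges.
\<close>

lemma moment_equations_solution:
  fixes a b A B C n m\<^sub>1 m\<^sub>2 :: real
  assumes s: "a + b > 0" and D: "1 - (A + 2 * C + B - 2 * a - 2 * b + 1) > 0"
    and m1: "m\<^sub>1 = (1 - a - b) * m\<^sub>1 + n * a"
    and m2: "m\<^sub>2 = m\<^sub>2 + (2 * (n * m\<^sub>1 - m\<^sub>2) + (n - m\<^sub>1)) * a + (m\<^sub>1 - 2 * m\<^sub>2) * b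
      + ((n\<^sup>2 - 2 * n * m\<^sub>1 + m\<^sub>2) - (n - m\<^sub>1)) * A + (- 2 * (n * m\<^sub>1 - m\<^sub>2)) * C + (m\<^sub>2 - m\<^sub>1) * B"
  shows "m\<^sub>1 = n * (a / (a + b))"
    and "m\<^sub>2 - m\<^sub>1\<^sup>2 =
      (B * a\<^sup>2 - 2 * C * a * b + A * b\<^sup>2) / ((1 - (A + 2 * C + B - 2 * a - 2 * b + 1)) * (a + b)\<^sup>2) * n\<^sup>2
      + (- B * a + 2 * a * b - A * b) / ((1 - (A + 2 * C + B - 2 * a - 2 * b + 1)) * (a + b)) * n"
proof -
  define D s where "D = 1 - (A + 2 * C + B - 2 * a - 2 * b + 1)" and "s = a + b"
  have m1': "m\<^sub>1 * s = n * a" using m1 by (simp add: s_def algebra_simps)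
  then show "m\<^sub>1 = n * (a / (a + b))" using s by (simp add: s_def field_simps)
  have "(m\<^sub>2 - m\<^sub>1\<^sup>2) * (D * s\<^sup>2)
      = (B * a\<^sup>2 - 2 * C * a * b + A * b\<^sup>2) * n\<^sup>2 + (- B * a + 2 * a * b - A * b) * s * n"
    using m1' m2 unfolding D_def s_def by algebra
  moreover have nz: "D \<noteq> 0" "s \<noteq> 0" using s D by (simp_all add: D_def s_def)
  ultimately have "m\<^sub>2 - m\<^sub>1\<^sup>2 = ((B * a\<^sup>2 - 2 * C * a * b + A * b\<^sup>2) * n\<^sup>2
      + (- B * a + 2 * a * b - A * b) * s * n) / (D * s\<^sup>2)"
    by (simp add: eq_divide_eq)
  then have "m\<^sub>2 - m\<^sub>1\<^sup>2 =
      (B * a\<^sup>2 - 2 * C * a * b + A * b\<^sup>2) / (D * s\<^sup>2) * n\<^sup>2 + (- B * a + 2 * a * b - A * b) / (D * s) * n"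
    using nz by (simp only: add_divide_distrib[of "_ * n\<^sup>2"]) (simp add: power2_eq_square[of s])
  then show "m\<^sub>2 - m\<^sub>1\<^sup>2 =
      (B * a\<^sup>2 - 2 * C * a * b + A * b\<^sup>2) / ((1 - (A + 2 * C + B - 2 * a - 2 * b + 1)) * (a + b)\<^sup>2) * n\<^sup>2
      + (- B * a + 2 * a * b - A * b) / ((1 - (A + 2 * C + B - 2 * a - 2 * b + 1)) * (a + b)) * n"
    unfolding D_def s_def .
qed

section \<open>The edge count of the graph process\<close>

lemma (in prob_space) expectation_finite_range:
  fixes \<phi> :: "'s \<Rightarrow> real"
  assumes I: "finite I"
    and range: "\<And>\<omega>. \<omega> \<in> space M \<Longrightarrow> Z \<omega> \<in> I"
    and events: "\<And>z. z \<in> I \<Longrightarrow> {\<omega> \<in> space M. Z \<omega> = z} \<in> events"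
  shows "expectation (\<lambda>\<omega>. \<phi> (Z \<omega>)) = (\<Sum>z\<in>I. \<phi> z * prob {\<omega> \<in> space M. Z \<omega> = z})"
proof -
  have "expectation (\<lambda>\<omega>. \<phi> (Z \<omega>))
      = expectation (\<lambda>\<omega>. \<Sum>z\<in>I. \<phi> z * indicator {\<omega> \<in> space M. Z \<omega> = z} \<omega>)"
  proof (rule Bochner_Integration.integral_cong[OF refl])
    fix \<omega> assume w: "\<omega> \<in> space M"
    have "(\<Sum>z\<in>I. \<phi> z * indicator {\<omega> \<in> space M. Z \<omega> = z} \<omega>)
        = (\<Sum>z\<in>I. if z = Z \<omega> then \<phi> z else 0)"
      using w by (intro sum.cong) (auto simp: indicator_def)
    then show "\<phi> (Z \<omega>) = (\<Sum>z\<in>I. \<phi> z * indicator {\<omega> \<in> space M. Z \<omega> = z} \<omega>)"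
      using I range[OF w] by simp
  qed
  also have "\<dots> = (\<Sum>z\<in>I. \<phi> z * prob {\<omega> \<in> space M. Z \<omega> = z})"
    using events by (subst Bochner_Integration.integral_sum) (auto intro!: integrable_real_indicator simp: emeasure_eq_measure)
  finally show ?thesis .
qed

context resampled_graph
begin

sublocale resampling_parameters Q P R
  by unfold_locales (use measurable_generic generic_range in auto)

lemma graph_subset:
  assumes "\<omega> \<in> space M"
  shows "X m \<omega> \<in> Pow {..<N}"
  using measurable_space[OF measurable_graph assms] by simp

lemma graph_event: "X m -` A \<inter> space M \<in> M.events"
proof -
  have "X m -` A \<inter> space M = X m -` (A \<inter> Pow {..<N}) \<inter> space M"
    using graph_subset by blast
  also have "\<dots> \<in> M.events"
    by (rule measurable_sets[OF measurable_graph]) auto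
  finally show ?thesis .
qed

lemma slot_parameters_measurable:
  "1 \<le> k \<Longrightarrow> (\<lambda>\<omega>. (Ps k \<omega>, Rs k \<omega>)) \<in> borel_measurable M"
  using indep by (auto simp: M.indep_vars_def)

lemma history_subalgebra: "subalgebra M (history M Ps Rs X m n)"
proof -
  let ?G = "{X k -` A \<inter> space M | k A. k \<le> m} \<union>
    {(\<lambda>\<omega>. (Ps k \<omega>, Rs k \<omega>)) -` B \<inter> space M | k B. k \<in> {1..n} \<and> B \<in> sets borel}"
  have "?G \<subseteq> M.events"
    using graph_event measurable_sets[OF slot_parameters_measurable] by auto
  then have "sigma_sets (space M) ?G \<subseteq> M.events"
    by (rule sets.sigma_sets_subset)
  moreover have "?G \<subseteq> Pow (space M)" by auto
  ultimately show ?thesis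
    by (simp add: subalgebra_def history_def space_measure_of sets_measure_of)
qed

lemma present_graph_in_history: "X m -` A \<inter> space M \<in> sets (history M Ps Rs X m n)"
  unfolding history_def by (rule in_measure_of) auto

text \<open>
  Independence of a pair of random variables is a notion for two variables of one type, so the
  pair of parameters enters through a real function of it.
\<close>

lemma graph_indep_next_parameters:
  fixes f :: "real \<times> real \<Rightarrow> real"
  assumes f [measurable]: "f \<in> borel_measurable borel"
  shows "M.indep_var borel (indicator (X m -` A \<inter> space M))
    borel (\<lambda>\<omega>. f (Ps (Suc m) \<omega>, Rs (Suc m) \<omega>))"
proof -
  let ?A = "X m -` A \<inter> space M"
  let ?V = "\<lambda>\<omega>. (Ps (Suc m) \<omega>, Rs (Suc m) \<omega>)"
  let ?H = "history M Ps Rs X m m"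
  let ?S = "vimage_algebra (space M) ?V borel"
  have V [measurable]: "?V \<in> borel_measurable M" by (rule slot_parameters_measurable) simp
  have A: "?A \<in> sets ?H" by (rule present_graph_in_history)
  have sp: "space ?H = space M" using history_subalgebra by (simp add: subalgebra_def)
  have "(indicator ?A :: _ \<Rightarrow> real) \<in> borel_measurable ?H" using A by simp
  then have past: "sigma_sets (space M) {(indicator ?A :: _ \<Rightarrow> real) -` B \<inter> space M | B. B \<in> sets borel}
      \<subseteq> sets ?H"
    unfolding sp[symmetric] by (intro sets.sigma_sets_subset) (auto dest: measurable_sets)
  have "?V \<in> measurable ?S borel" by (rule measurable_vimage_algebra1) simp
  then have "(\<lambda>\<omega>. f (?V \<omega>)) \<in> borel_measurable ?S" by (rule measurable_compose[OF _ f])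
  then have "sigma_sets (space ?S) {(\<lambda>\<omega>. f (?V \<omega>)) -` B \<inter> space ?S | B. B \<in> sets borel} \<subseteq> sets ?S"
    by (intro sets.sigma_sets_subset) (auto dest: measurable_sets)
  then have slot: "sigma_sets (space M) {(\<lambda>\<omega>. f (?V \<omega>)) -` B \<inter> space M | B. B \<in> sets borel}
      \<subseteq> {?V -` B \<inter> space M | B. B \<in> sets borel}"
    by (simp add: sets_vimage_algebra2)
  have "M.indep_set (sigma_sets (space M) {(indicator ?A :: _ \<Rightarrow> real) -` B \<inter> space M | B. B \<in> sets borel})
      (sigma_sets (space M) {(\<lambda>\<omega>. f (?V \<omega>)) -` B \<inter> space M | B. B \<in> sets borel})"
    unfolding M.indep_sets2_eq
  proof (intro conjI ballI)
    show "M.prob (a \<inter> b) = M.prob a * M.prob b"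
      if "a \<in> sigma_sets (space M) {(indicator ?A :: _ \<Rightarrow> real) -` B \<inter> space M | B. B \<in> sets borel}"
        and "b \<in> sigma_sets (space M) {(\<lambda>\<omega>. f (?V \<omega>)) -` B \<inter> space M | B. B \<in> sets borel}" for a b
      using M.indep_setD[OF indep_past subsetD[OF past that(1)] subsetD[OF slot that(2)]] .
  qed (rule subset_trans[OF past M.indep_setD_ev1[OF indep_past]]
      subset_trans[OF slot M.indep_setD_ev2[OF indep_past]])+
  then show ?thesis
    unfolding M.indep_var_eq using graph_event by auto
qed

text \<open>
  The transition rule, integrated over the event that the current graph is \<open>S\<close>, gives the
  integral of the transition probability over that event. There the current graph may be replaced
  by \<open>S\<close>, and what remains depends on the fresh parameters only, hence is independent of the event
  and has the law of the generic copy.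
\<close>

lemma joint_law_graph:
  assumes T: "T \<subseteq> {..<N}"
  shows "M.prob {\<omega> \<in> space M. X m \<omega> = S \<and> X (Suc m) \<omega> = T}
    = M.prob {\<omega> \<in> space M. X m \<omega> = S} * Q.expectation (\<lambda>\<omega>. graph_trans N (P \<omega>) (R \<omega>) S T)"
proof -
  let ?H = "history M Ps Rs X m (Suc m)"
  let ?V = "\<lambda>\<omega>. (Ps (Suc m) \<omega>, Rs (Suc m) \<omega>)"
  let ?A = "X m -` {S} \<inter> space M"
  let ?B = "{\<omega> \<in> space M. X (Suc m) \<omega> = T}"
  define f where "f = (\<lambda>(p, r). graph_trans N p r S T)"
  interpret H: finite_measure_subalgebra M ?H
    by unfold_locales (rule history_subalgebra)
  have V [measurable]: "?V \<in> borel_measurable M" by (rule slot_parameters_measurable) simp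
  have A [measurable]: "?A \<in> M.events" by (rule graph_event)
  have B [measurable]: "?B \<in> M.events"
    using graph_event[of "Suc m" "{T}"] by (simp add: vimage_def Int_def conj_commute)
  have f [measurable]: "f \<in> borel_measurable borel"
    unfolding f_def graph_trans_def edge_trans_def borel_prod[symmetric] by measurable
  have fV: "integrable M (\<lambda>\<omega>. f (?V \<omega>))"
  proof (rule M.integrable_const_bound[where B = 1])
    show "AE \<omega> in M. norm (f (?V \<omega>)) \<le> 1"
      using range[of "Suc m"] graph_trans_pos graph_trans_le_1
      by (intro AE_I2) (simp add: f_def less_imp_le)
  qed measurable
  have "M.prob {\<omega> \<in> space M. X m \<omega> = S \<and> X (Suc m) \<omega> = T} = M.prob (?A \<inter> ?B)"
    by (rule arg_cong[where f = M.prob]) auto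
  also have "\<dots> = (\<integral>\<omega>\<in>?A. indicator ?B \<omega> \<partial>M)"
    by (simp add: set_lebesgue_integral_def flip: indicator_inter_arith)
  also have "\<dots> = (\<integral>\<omega>\<in>?A. real_cond_exp M ?H (indicator ?B) \<omega> \<partial>M)"
    by (rule H.real_cond_exp_intA)
      (auto intro!: integrable_real_indicator present_graph_in_history simp: M.emeasure_eq_measure)
  also have "\<dots> = M.expectation (\<lambda>\<omega>. indicator ?A \<omega> * f (?V \<omega>))"
    unfolding set_lebesgue_integral_def
  proof (rule integral_cong_AE)
    show "AE \<omega> in M. indicat_real ?A \<omega> *\<^sub>R real_cond_exp M ?H (indicator ?B) \<omega>
        = indicator ?A \<omega> * f (?V \<omega>)"
      using transition[OF T, of m] by eventually_elim (auto simp: f_def indicator_def)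
  qed measurable
  also have "\<dots> = M.expectation (indicator ?A) * M.expectation (\<lambda>\<omega>. f (?V \<omega>))"
  proof (rule M.indep_var_lebesgue_integral)
    show "M.indep_var borel (indicator ?A) borel (\<lambda>\<omega>. f (?V \<omega>))"
      by (rule graph_indep_next_parameters[OF f])
  qed (use fV in \<open>auto intro!: integrable_real_indicator simp: M.emeasure_eq_measure\<close>)
  also have "M.expectation (indicator ?A) = M.prob {\<omega> \<in> space M. X m \<omega> = S}"
    by (simp add: vimage_def Int_def conj_commute)
  also have "M.expectation (\<lambda>\<omega>. f (?V \<omega>)) = (\<integral>x. f x \<partial>distr M borel ?V)"
    by (simp add: integral_distr)
  also have "distr M borel ?V = distr Q borel (\<lambda>\<omega>. (P \<omega>, R \<omega>))"
    by (rule identically_distributed) simp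
  also have "(\<integral>x. f x \<partial>distr Q borel (\<lambda>\<omega>. (P \<omega>, R \<omega>))) = Q.expectation (\<lambda>\<omega>. f (P \<omega>, R \<omega>))"
    by (rule integral_distr) measurable
  finally show ?thesis by (simp add: f_def)
qed

definition count_law :: "nat \<Rightarrow> nat \<Rightarrow> real" where
  "count_law m i = M.prob {\<omega> \<in> space M. card (X m \<omega>) = i}"

lemma expectation_count:
  "M.expectation (\<lambda>\<omega>. g (card (X m \<omega>))) = (\<Sum>i\<le>N. g i * count_law m i)"
  unfolding count_law_def
proof (rule M.expectation_finite_range)
  show "card (X m \<omega>) \<in> {..N}" if "\<omega> \<in> space M" for \<omega>
    using card_mono[of "{..<N}" "X m \<omega>"] graph_subset[OF that, of m] by simp
  show "{\<omega> \<in> space M. card (X m \<omega>) = i} \<in> M.events" for i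
    using graph_event[of m "{S. card S = i}"] by (simp add: vimage_def Int_def conj_commute)
qed simp

text \<open>
  By the symmetry of the edges, the probability of moving to some graph with \<open>j\<close> edges depends on
  the current graph through its number of edges only. Grouping the graphs by this number turns the
  joint law of two graphs into that of two counts; stated for expectations, it yields the recursion
  for the law of the count as well as the covariance.
\<close>

lemma expectation_consecutive_counts:
  "M.expectation (\<lambda>\<omega>. g (card (X m \<omega>)) * h (card (X (Suc m) \<omega>)))
    = (\<Sum>i\<le>N. count_law m i * (g i * (\<Sum>j\<le>N. h j * count_kernel Q P R N i j)))"
proof -
  have event: "{\<omega> \<in> space M. X m \<omega> = S} \<in> M.events" for m S
    using graph_event[of m "{S}"] by (simp add: vimage_def Int_def conj_commute)
  have "M.expectation (\<lambda>\<omega>. (\<lambda>(S, T). g (card S) * h (card T)) (X m \<omega>, X (Suc m) \<omega>))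
      = (\<Sum>z\<in>Pow {..<N} \<times> Pow {..<N}. (\<lambda>(S, T). g (card S) * h (card T)) z
          * M.prob {\<omega> \<in> space M. (X m \<omega>, X (Suc m) \<omega>) = z})"
  proof (rule M.expectation_finite_range)
    fix z assume "z \<in> Pow {..<N} \<times> Pow {..<N}"
    have "{\<omega> \<in> space M. X m \<omega> = fst z} \<inter> {\<omega> \<in> space M. X (Suc m) \<omega> = snd z} \<in> M.events"
      by (intro sets.Int event)
    also have "{\<omega> \<in> space M. X m \<omega> = fst z} \<inter> {\<omega> \<in> space M. X (Suc m) \<omega> = snd z}
        = {\<omega> \<in> space M. (X m \<omega>, X (Suc m) \<omega>) = z}" by auto
    finally show "{\<omega> \<in> space M. (X m \<omega>, X (Suc m) \<omega>) = z} \<in> M.events" .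
  qed (use graph_subset in auto)
  also have "\<dots> = (\<Sum>S\<in>Pow {..<N}. \<Sum>T\<in>Pow {..<N}. g (card S) * h (card T)
      * M.prob {\<omega> \<in> space M. X m \<omega> = S \<and> X (Suc m) \<omega> = T})"
    by (simp add: sum.cartesian_product case_prod_unfold prod_eq_iff)
  also have "\<dots> = (\<Sum>S\<in>Pow {..<N}. g (card S) * (\<Sum>j\<le>N. h j * count_kernel Q P R N (card S) j)
      * M.prob {\<omega> \<in> space M. X m \<omega> = S})"
  proof (rule sum.cong[OF refl])
    fix S assume "S \<in> Pow {..<N}"
    then have S: "S \<subseteq> {..<N}" by simp
    have "(\<Sum>T\<in>Pow {..<N}. g (card S) * h (card T)
          * M.prob {\<omega> \<in> space M. X m \<omega> = S \<and> X (Suc m) \<omega> = T})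
        = (\<Sum>T\<in>Pow {..<N}. g (card S) * M.prob {\<omega> \<in> space M. X m \<omega> = S}
          * (h (card T) * Q.expectation (\<lambda>\<omega>. graph_trans N (P \<omega>) (R \<omega>) S T)))"
      by (rule sum.cong) (simp_all add: joint_law_graph)
    then show "(\<Sum>T\<in>Pow {..<N}. g (card S) * h (card T)
          * M.prob {\<omega> \<in> space M. X m \<omega> = S \<and> X (Suc m) \<omega> = T})
        = g (card S) * (\<Sum>j\<le>N. h j * count_kernel Q P R N (card S) j)
          * M.prob {\<omega> \<in> space M. X m \<omega> = S}"
      by (simp add: sum_expected_graph_trans[OF S] flip: sum_distrib_left)
  qed
  also have "\<dots> = M.expectation (\<lambda>\<omega>. g (card (X m \<omega>))
      * (\<Sum>j\<le>N. h j * count_kernel Q P R N (card (X m \<omega>)) j))"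
    by (rule M.expectation_finite_range[symmetric]) (use event graph_subset in auto)
  also have "\<dots> = (\<Sum>i\<le>N. g i * (\<Sum>j\<le>N. h j * count_kernel Q P R N i j) * count_law m i)"
    by (rule expectation_count)
  finally show ?thesis by (simp add: mult_ac)
qed

lemma count_law_total: "(\<Sum>i\<le>N. count_law m i) = 1"
  using expectation_count[of "\<lambda>_. 1" m] by (simp add: M.prob_space)

lemma count_law_step:
  assumes j: "j \<le> N"
  shows "count_law (Suc m) j = (\<Sum>i\<le>N. count_law m i * count_kernel Q P R N i j)"
proof -
  have pick: "(\<Sum>i\<le>N. of_bool (i = j) * f i) = f j" for f :: "nat \<Rightarrow> real"
  proof -
    have "(\<Sum>i\<le>N. of_bool (i = j) * f i) = (\<Sum>i\<le>N. if i = j then f i else 0)"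
      by (rule sum.cong) auto
    then show ?thesis using j by simp
  qed
  have "count_law (Suc m) j = M.expectation (\<lambda>\<omega>. of_bool (card (X (Suc m) \<omega>) = j))"
    unfolding expectation_count[of "\<lambda>i. of_bool (i = j)" "Suc m"] pick ..
  also have "\<dots> = (\<Sum>i\<le>N. count_law m i
      * (1 * (\<Sum>k\<le>N. of_bool (k = j) * count_kernel Q P R N i k)))"
    unfolding expectation_consecutive_counts[of "\<lambda>_. 1" m "\<lambda>i. of_bool (i = j)", symmetric] by simp
  finally show ?thesis unfolding pick by simp
qed

lemma count_law_tendsto:
  assumes "stationary_count Q P R N \<pi>" "j \<le> N"
  shows "(\<lambda>m. count_law m j) \<longlonglongrightarrow> pmf \<pi> j"
  by (rule count_chain_tendsto[where \<mu>=count_law, OF assms(1) count_law_step count_law_total assms(2)])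

lemma expectation_count_tendsto:
  fixes g :: "nat \<Rightarrow> real"
  assumes "stationary_count Q P R N \<pi>"
  shows "(\<lambda>m. M.expectation (\<lambda>\<omega>. g (card (X m \<omega>)))) \<longlonglongrightarrow> measure_pmf.expectation \<pi> g"
  unfolding expectation_count[of g] stationary_count_expectation[OF assms]
  by (intro tendsto_sum tendsto_mult_left count_law_tendsto[OF assms]) simp

end

text \<open>
  The covariance is a finite sum that depends continuously on the law of the count and on the two
  means, and the conditional mean of the next count is affine in the current one. Hence the limit is
  the same expression for the stationary law.
\<close>

lemma (in resampled_graph) covariance_count_tendsto:
  assumes st: "stationary_count Q P R N \<pi>"
  shows "(\<lambda>m. covariance M (\<lambda>\<omega>. real (card (X m \<omega>))) (\<lambda>\<omega>. real (card (X (Suc m) \<omega>))))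
    \<longlonglongrightarrow> (Q.expectation P + Q.expectation R - 1) * measure_pmf.expectation \<pi> (\<lambda>y. (real y)\<^sup>2)
      + (1 - Q.expectation P) * real N * measure_pmf.expectation \<pi> real
      - (measure_pmf.expectation \<pi> real)\<^sup>2"
proof -
  define c where "c m = M.expectation (\<lambda>\<omega>. real (card (X m \<omega>)))" for m
  define e where "e = measure_pmf.expectation \<pi> real"
  define \<alpha> \<beta> where "\<alpha> = 1 - Q.expectation (\<lambda>\<omega>. 1 - P \<omega>) - Q.expectation (\<lambda>\<omega>. 1 - R \<omega>)"
    and "\<beta> = real N * Q.expectation (\<lambda>\<omega>. 1 - P \<omega>)"
  have fixpoint: "e = \<alpha> * e + \<beta>"
    unfolding e_def \<alpha>_def \<beta>_def by (rule stationary_mean_equation[OF st])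
  have c: "c \<longlonglongrightarrow> e"
    unfolding c_def e_def by (rule expectation_count_tendsto[OF st])
  have row: "(\<Sum>j\<le>N. (real j - d) * count_kernel Q P R N i j) = \<beta> + \<alpha> * real i - d"
    if "i \<le> N" for i d
  proof -
    have "(\<Sum>j\<le>N. (real j - d) * count_kernel Q P R N i j)
        = (\<Sum>j\<le>N. real j * count_kernel Q P R N i j) - d * (\<Sum>j\<le>N. count_kernel Q P R N i j)"
      by (simp add: left_diff_distrib sum_subtractf sum_distrib_left)
    then show ?thesis
      by (simp add: count_kernel_mean[OF that] count_kernel_total[OF that] \<alpha>_def \<beta>_def)
  qed
  have cov: "covariance M (\<lambda>\<omega>. real (card (X m \<omega>))) (\<lambda>\<omega>. real (card (X (Suc m) \<omega>)))
      = (\<Sum>i\<le>N. count_law m i * ((real i - c m) * (\<beta> + \<alpha> * real i - c (Suc m))))" for m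
    unfolding covariance_def c_def[symmetric]
      expectation_consecutive_counts[of "\<lambda>i. real i - c m" m "\<lambda>j. real j - c (Suc m)"]
    by (rule sum.cong) (simp_all add: row)
  have "(\<lambda>m. \<Sum>i\<le>N. count_law m i * ((real i - c m) * (\<beta> + \<alpha> * real i - c (Suc m))))
      \<longlonglongrightarrow> (\<Sum>i\<le>N. pmf \<pi> i * ((real i - e) * (\<beta> + \<alpha> * real i - e)))"
    by (intro tendsto_sum tendsto_mult tendsto_diff tendsto_const count_law_tendsto[OF st] c LIMSEQ_Suc[OF c]) simp
  also have "(\<Sum>i\<le>N. pmf \<pi> i * ((real i - e) * (\<beta> + \<alpha> * real i - e)))
      = (\<Sum>i\<le>N. pmf \<pi> i * ((e\<^sup>2 - \<beta> * e) + (\<beta> - e - \<alpha> * e) * real i + \<alpha> * (real i)\<^sup>2))"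
    by (rule sum.cong) (simp_all add: power2_eq_square algebra_simps)
  also have "\<dots> = (e\<^sup>2 - \<beta> * e) + (\<beta> - e - \<alpha> * e) * e
      + \<alpha> * measure_pmf.expectation \<pi> (\<lambda>y. (real y)\<^sup>2)"
    unfolding stationary_count_quadratic[OF st] e_def ..
  \<comment> \<open>The terms other than \<open>\<alpha> E Y\<^sup>2\<close> add up to \<open>- \<alpha> e\<^sup>2\<close>, which is \<open>\<beta> e - e\<^sup>2\<close> by stationarity of the mean.\<close>
  also have "\<dots> = \<alpha> * measure_pmf.expectation \<pi> (\<lambda>y. (real y)\<^sup>2) + \<beta> * e - e\<^sup>2"
    using fixpoint by algebra
  finally have "(\<lambda>m. covariance M (\<lambda>\<omega>. real (card (X m \<omega>))) (\<lambda>\<omega>. real (card (X (Suc m) \<omega>))))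
      \<longlonglongrightarrow> \<alpha> * measure_pmf.expectation \<pi> (\<lambda>y. (real y)\<^sup>2) + \<beta> * e - e\<^sup>2"
    unfolding cov .
  moreover have "\<alpha> = Q.expectation P + Q.expectation R - 1" "\<beta> = (1 - Q.expectation P) * real N"
    unfolding \<alpha>_def \<beta>_def expectation_parameters by simp_all
  ultimately show ?thesis unfolding e_def by simp
qed

theorem mainTheorem6:
  fixes M :: "'a measure" and Q :: "'b measure"
    and P R :: "'b \<Rightarrow> real"
    and Ps Rs :: "nat \<Rightarrow> 'a \<Rightarrow> real"
    and X :: "nat \<Rightarrow> 'a \<Rightarrow> nat set"
    and Y :: "nat \<Rightarrow> 'a \<Rightarrow> real"
    and N :: nat
  assumes graph: "resampled_graph M Q P R Ps Rs X N"
    and Y: "\<And>m \<omega>. Y m \<omega> = real (card (X m \<omega>))"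
  shows "(\<exists>!\<pi>. stationary_count Q P R N \<pi>) \<and>
    (\<forall>\<pi>. stationary_count Q P R N \<pi> \<longrightarrow>
      (let E = prob_space.expectation Q;
           P' = (\<lambda>\<omega>. 1 - P \<omega>);
           R' = (\<lambda>\<omega>. 1 - R \<omega>);
           EY = measure_pmf.expectation \<pi> (\<lambda>y. real y);
           EY2 = measure_pmf.expectation \<pi> (\<lambda>y. (real y)\<^sup>2);
           VarY = measure_pmf.variance \<pi> (\<lambda>y. real y);
           \<gamma>\<^sub>1 = (E (\<lambda>\<omega>. (R' \<omega>)\<^sup>2) * (E P')\<^sup>2 - 2 * E (\<lambda>\<omega>. P' \<omega> * R' \<omega>) * E P' * E R'
                   + E (\<lambda>\<omega>. (P' \<omega>)\<^sup>2) * (E R')\<^sup>2)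
                / ((1 - E (\<lambda>\<omega>. (P' \<omega> + R' \<omega> - 1)\<^sup>2)) * (E P' + E R')\<^sup>2);
           \<gamma>\<^sub>2 = (- E (\<lambda>\<omega>. (R' \<omega>)\<^sup>2) * E P' + 2 * E P' * E R' - E (\<lambda>\<omega>. (P' \<omega>)\<^sup>2) * E R')
                / ((1 - E (\<lambda>\<omega>. (P' \<omega> + R' \<omega> - 1)\<^sup>2)) * (E P' + E R'))
       in EY = real N * ((1 - E P) / (2 - E P - E R)) \<and>
          VarY = \<gamma>\<^sub>1 * (real N)\<^sup>2 + \<gamma>\<^sub>2 * real N \<and>
          (\<lambda>m. covariance M (Y m) (Y (Suc m)))
            \<longlonglongrightarrow> (E P + E R - 1) * EY2 + (1 - E P) * real N * EY - EY\<^sup>2))"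
proof -
  interpret resampled_graph M Q P R Ps Rs X N by (rule graph)
  define a b where "a = Q.expectation (\<lambda>\<omega>. 1 - P \<omega>)" and "b = Q.expectation (\<lambda>\<omega>. 1 - R \<omega>)"
  have EP: "Q.expectation P = 1 - a" and ER: "Q.expectation R = 1 - b"
    unfolding a_def b_def by (rule expectation_parameters)+
  have s: "0 < a + b"
    using expectation_absent_pos by (simp add: a_def b_def)
  have Yfun: "Y m = (\<lambda>\<omega>. real (card (X m \<omega>)))" for m
    by (rule ext) (rule Y)
  show ?thesis
    unfolding Let_def
  proof (intro conjI allI impI)
    show "\<exists>!\<pi>. stationary_count Q P R N \<pi>" by (rule stationary_count_unique_existence)
  next
    fix \<pi> assume st: "stationary_count Q P R N \<pi>"
    note moments = moment_equations_solution[OF s[unfolded a_def b_def] _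
        stationary_mean_equation[OF st] stationary_second_moment_equation[OF st],
        folded expectation_contraction_factor]
    have gap: "0 < 1 - Q.expectation (\<lambda>\<omega>. ((1 - P \<omega>) + (1 - R \<omega>) - 1)\<^sup>2)"
      using expectation_contraction_factor_less_1 by simp
    show "measure_pmf.expectation \<pi> real
        = real N * ((1 - Q.expectation P) / (2 - Q.expectation P - Q.expectation R))"
      unfolding moments(1)[OF gap] EP ER by (simp add: a_def b_def)
    show "(\<lambda>m. covariance M (Y m) (Y (Suc m))) \<longlonglongrightarrow>
        (Q.expectation P + Q.expectation R - 1) * measure_pmf.expectation \<pi> (\<lambda>y. (real y)\<^sup>2)
        + (1 - Q.expectation P) * real N * measure_pmf.expectation \<pi> real
        - (measure_pmf.expectation \<pi> real)\<^sup>2"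
      unfolding Yfun by (rule covariance_count_tendsto[OF st])
    show "measure_pmf.variance \<pi> real =
        (Q.expectation (\<lambda>\<omega>. (1 - R \<omega>)\<^sup>2) * (Q.expectation (\<lambda>\<omega>. 1 - P \<omega>))\<^sup>2
          - 2 * Q.expectation (\<lambda>\<omega>. (1 - P \<omega>) * (1 - R \<omega>)) * Q.expectation (\<lambda>\<omega>. 1 - P \<omega>)
            * Q.expectation (\<lambda>\<omega>. 1 - R \<omega>)
          + Q.expectation (\<lambda>\<omega>. (1 - P \<omega>)\<^sup>2) * (Q.expectation (\<lambda>\<omega>. 1 - R \<omega>))\<^sup>2)
        / ((1 - Q.expectation (\<lambda>\<omega>. ((1 - P \<omega>) + (1 - R \<omega>) - 1)\<^sup>2))
            * (Q.expectation (\<lambda>\<omega>. 1 - P \<omega>) + Q.expectation (\<lambda>\<omega>. 1 - R \<omega>))\<^sup>2) * (real N)\<^sup>2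
        + (- Q.expectation (\<lambda>\<omega>. (1 - R \<omega>)\<^sup>2) * Q.expectation (\<lambda>\<omega>. 1 - P \<omega>)
          + 2 * Q.expectation (\<lambda>\<omega>. 1 - P \<omega>) * Q.expectation (\<lambda>\<omega>. 1 - R \<omega>)
          - Q.expectation (\<lambda>\<omega>. (1 - P \<omega>)\<^sup>2) * Q.expectation (\<lambda>\<omega>. 1 - R \<omega>))
        / ((1 - Q.expectation (\<lambda>\<omega>. ((1 - P \<omega>) + (1 - R \<omega>) - 1)\<^sup>2))
            * (Q.expectation (\<lambda>\<omega>. 1 - P \<omega>) + Q.expectation (\<lambda>\<omega>. 1 - R \<omega>))) * real N"
      unfolding stationary_variance[OF st] by (rule moments(2)[OF gap])
  qed
qed

end
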